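(* For any braid diagram $B$, if $\det(B)\neq 0$ then $\mathrm{wd}(B)\neq 0$.
   Context: An $n$-braid diagram $B$ ($n\ge 1$) is the planar diagram of a braid on $n$ strands, given by a word in $\sigma_1^{\pm1},\dots,\sigma_{n-1}^{\pm1}$ read from top to bottom; $\sigma_k$ (a positive crossing) is a crossing of the strands currently at positions $k$ and $k+1$ in which the strand going from position $k$ to position $k+1$ passes under the other, and $\sigma_k^{-1}$ is the same with the other strand passing under. The strands are labelled $s_1,\dots,s_n$ from left to right at the top. A strand permutation $\pi$ of $\{1,\dots,n\}$ corresponds to the sequence of strands $\mathbf{s}=(s_{\pi(1)},\dots,s_{\pi(n)})$. The OU (over-under) matrix $M(B_{\mathbf{s}})=M_B(\pi)$ is the $n\times n$ matrix with zero diagonal whose $(i,j)$-entry for $i\neq j$ is the number of crossings of $B$ at which $s_{\pi(i)}$ passes over $s_{\pi(j)}$. Its determinant does not depend on $\pi$ and is denoted $\det(B)$. The warping degree $\mathrm{wd}(B_{\mathbf{s}})$ is the total number of crossings of $B$ at which the strand that comes earlier in the sequence $\mathbf{s}$ passes under the strand that comes later in $\mathbf{s}$. The warping degree $\mathrm{wd}(B)$ is the minimum of $\mathrm{wd}(B_{\mathbf{s}})$ over all orderings $\mathbf{s}$ of the strands. *)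

theory Defs
  imports "Jordan_Normal_Form.Determinant" "HOL-Combinatorics.Permutations"
begin

text \<open>
  Positions and strand labels are \<open>1, \<dots>, n\<close>.  Matrices are 0-based, so row \<open>i\<close> of a
  matrix belongs to the \<open>Suc i\<close>-th strand of the sequence.
\<close>

datatype braid_gen = Sig nat | Sig_inv nat

primrec gen_index :: "braid_gen \<Rightarrow> nat" where
  "gen_index (Sig k) = k"
| "gen_index (Sig_inv k) = k"

definition braid_diagram :: "nat \<Rightarrow> braid_gen list \<Rightarrow> bool" where
  "braid_diagram n B \<longleftrightarrow> 1 \<le> n \<and> (\<forall>g\<in>set B. 1 \<le> gen_index g \<and> gen_index g < n)"

text \<open>
  \<open>crossings_from a B\<close> lists, from top to bottom, the crossings of \<open>B\<close> as pairs
  (label of the over-strand, label of the under-strand), where \<open>a k\<close> is the label of the strand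
  at position \<open>k\<close> above the first letter.  At \<open>Sig k\<close> the strand leaving position \<open>k\<close> is the
  under-strand.
\<close>

fun crossings_from :: "(nat \<Rightarrow> nat) \<Rightarrow> braid_gen list \<Rightarrow> (nat \<times> nat) list" where
  "crossings_from a [] = []"
| "crossings_from a (Sig k # B) =
     (a (Suc k), a k) # crossings_from (a \<circ> Transposition.transpose k (Suc k)) B"
| "crossings_from a (Sig_inv k # B) =
     (a k, a (Suc k)) # crossings_from (a \<circ> Transposition.transpose k (Suc k)) B"

definition crossings :: "braid_gen list \<Rightarrow> (nat \<times> nat) list" where
  "crossings B = crossings_from id B"

definition over_count :: "braid_gen list \<Rightarrow> nat \<Rightarrow> nat \<Rightarrow> nat" where
  "over_count B p q = count_list (crossings B) (p, q)"

definition OU_matrix :: "nat \<Rightarrow> braid_gen list \<Rightarrow> (nat \<Rightarrow> nat) \<Rightarrow> int mat" where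
  "OU_matrix n B \<pi> = mat n n (\<lambda>(i, j).
     if i = j then 0 else int (over_count B (\<pi> (Suc i)) (\<pi> (Suc j))))"

text \<open>
  The choice of the identity permutation is immaterial: see \<open>det_OU_matrix_eq_braid_det\<close>.
\<close>

definition braid_det :: "nat \<Rightarrow> braid_gen list \<Rightarrow> int" where
  "braid_det n B = det (OU_matrix n B id)"

lemma det_OU_matrix_eq_braid_det:
  assumes "\<pi> permutes {1..n}"
  shows "det (OU_matrix n B \<pi>) = braid_det n B"
proof -
  define p where "p = (\<lambda>i. if i < n then \<pi> (Suc i) - 1 else i)"
  have range: "\<pi> (Suc i) \<in> {1..n}" if "i < n" for i
    using permutes_in_image[OF assms, of "Suc i"] that by auto
  have Suc_p: "Suc (p i) = \<pi> (Suc i)" if "i < n" for i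
    using range[OF that] that by (auto simp: p_def)
  have p_less: "p i < n" if "i < n" for i
    using range[OF that] Suc_p[OF that] by auto
  have inj: "inj_on p {0..<n}"
  proof (rule inj_onI)
    fix i j assume "i \<in> {0..<n}" "j \<in> {0..<n}" "p i = p j"
    then have "\<pi> (Suc i) = \<pi> (Suc j)" using Suc_p[of i] Suc_p[of j] by simp
    then show "i = j" using permutes_inj[OF assms] by (auto dest: injD)
  qed
  have p: "p permutes {0..<n}"
  proof (rule bij_imp_permutes)
    have "p ` {0..<n} = {0..<n}"
      using inj p_less by (intro endo_inj_surj) auto
    with inj show "bij_betw p {0..<n} {0..<n}" by (simp add: bij_betw_def)
  qed (simp add: p_def)
  let ?A = "OU_matrix n B id"
  let ?R = "mat n n (\<lambda>(i, j). ?A $$ (p i, j))"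
  let ?C = "mat n n (\<lambda>(i, j). (transpose_mat ?R) $$ (p i, j))"
  have A: "?A \<in> carrier_mat n n" by (simp add: OU_matrix_def)
  have R: "?R \<in> carrier_mat n n" by simp
  have eq: "OU_matrix n B \<pi> = transpose_mat ?C"
  proof (rule eq_matI)
    fix i j assume "i < dim_row (transpose_mat ?C)" "j < dim_col (transpose_mat ?C)"
    then have ij: "i < n" "j < n" by auto
    have "p i = p j \<longleftrightarrow> i = j" using inj ij by (auto dest: inj_onD)
    then show "OU_matrix n B \<pi> $$ (i, j) = transpose_mat ?C $$ (i, j)"
      using ij p_less[OF ij(1)] p_less[OF ij(2)] Suc_p[OF ij(1)] Suc_p[OF ij(2)]
      by (simp add: OU_matrix_def)
  qed (simp_all add: OU_matrix_def)
  have "det (OU_matrix n B \<pi>) = det ?C"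
    unfolding eq by (rule det_transpose[of _ n]) simp
  also have "\<dots> = signof p * det (transpose_mat ?R)"
    by (rule det_permute_rows[OF _ p]) simp
  also have "\<dots> = signof p * (signof p * det ?A)"
    by (simp only: det_transpose[OF R] det_permute_rows[OF A p])
  also have "\<dots> = det ?A" by (simp add: sign_def)
  finally show ?thesis by (simp add: braid_det_def)
qed

definition warping_degree_seq :: "nat \<Rightarrow> braid_gen list \<Rightarrow> (nat \<Rightarrow> nat) \<Rightarrow> nat" where
  "warping_degree_seq n B \<pi> =
     length (filter (\<lambda>(p, q). \<exists>i j. 1 \<le> i \<and> i < j \<and> j \<le> n \<and> q = \<pi> i \<and> p = \<pi> j) (crossings B))"

definition warping_degree :: "nat \<Rightarrow> braid_gen list \<Rightarrow> nat" where
  "warping_degree n B = (MIN \<pi>\<in>{\<pi>. \<pi> permutes {1..n}}. warping_degree_seq n B \<pi>)"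

end

theory Submission
  imports Defs
begin

text \<open>
  An ordering of the strands with warping degree \<open>0\<close> makes the OU matrix strictly upper
  triangular, so its determinant, which does not depend on the ordering, vanishes.
\<close>

text \<open>\<open>Min\<close> is meaningful only on a finite nonempty set: there are finitely many
  permutations, and the identity is one.\<close>

lemma warping_degree_attained:
  obtains \<pi> where "\<pi> permutes {1..n}" "warping_degree n B = warping_degree_seq n B \<pi>"
proof -
  let ?P = "{\<pi>. \<pi> permutes {1..n}}"
  have "finite ?P" by (simp add: finite_permutations)
  moreover have "?P \<noteq> {}" using permutes_id by blast
  ultimately have "warping_degree n B \<in> warping_degree_seq n B ` ?P"
    unfolding warping_degree_def by (intro Min_in) auto
  then show ?thesis using that by auto
qed

text \<open>Any crossing of the later strand over the earlier one would itself be counted by the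
  warping degree.\<close>

lemma over_count_eq_0_if_warping_degree_seq_eq_0:
  assumes "warping_degree_seq n B \<pi> = 0" "1 \<le> i" "i < j" "j \<le> n"
  shows "over_count B (\<pi> j) (\<pi> i) = 0"
  using assms by (fastforce simp: warping_degree_seq_def over_count_def count_list_0_iff filter_empty_conv)

text \<open>Below the diagonal the row strand comes later than the column strand, so the entries
  there count warping crossings.\<close>

lemma upper_triangular_OU_matrix:
  assumes "warping_degree_seq n B \<pi> = 0"
  shows "upper_triangular (OU_matrix n B \<pi>)"
  using over_count_eq_0_if_warping_degree_seq_eq_0[OF assms]
  by (auto simp: upper_triangular_def OU_matrix_def)

lemma det_OU_matrix_eq_0:
  assumes "1 \<le> n" "warping_degree_seq n B \<pi> = 0"
  shows "det (OU_matrix n B \<pi>) = 0"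
proof -
  have "det (OU_matrix n B \<pi>) = prod_list (diag_mat (OU_matrix n B \<pi>))"
    by (rule det_upper_triangular[OF upper_triangular_OU_matrix[OF assms(2)], of n])
      (simp add: OU_matrix_def)
  also have "\<dots> = 0"
  proof -
    \<comment> \<open>The empty matrix has determinant 1; \<open>1 \<le> n\<close> provides a
      diagonal entry.\<close>
    have "OU_matrix n B \<pi> $$ (0, 0) = 0" "dim_row (OU_matrix n B \<pi>) = n"
      using assms(1) by (simp_all add: OU_matrix_def)
    then have "0 \<in> set (diag_mat (OU_matrix n B \<pi>))"
      using assms(1) by (force simp: diag_mat_def)
    then show ?thesis by (simp add: prod_list_zero_iff)
  qed
  finally show ?thesis .
qed

theorem theorem2:
  fixes n :: nat and B :: "braid_gen list"
  assumes "braid_diagram n B"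
    and "braid_det n B \<noteq> 0"
  shows "warping_degree n B \<noteq> 0"
proof
  assume "warping_degree n B = 0"
  then obtain \<pi> where "\<pi> permutes {1..n}" "warping_degree_seq n B \<pi> = 0"
    by (metis warping_degree_attained)
  \<comment> \<open>\<open>braid_det\<close> is taken at the identity ordering, so its value is
    first carried over to \<open>\<pi>\<close>.\<close>
  with assms show False
    by (metis braid_diagram_def det_OU_matrix_eq_braid_det det_OU_matrix_eq_0)
qed

end
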